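(* Let $N\ge2$ be an integer. Suppose $u_0\in C^1(\mathbb{R})$ is a decreasing function, and let $\tau'$ be a spatially independent stopping time and $u\in\mathcal{C}^1([0,\tau'];\mathbb{R})$ be a solution, with initial data $u_0$, of the particle system (without resetting) $$X^{i}_t(a)=a+\int_0^{\tau'\wedge t}u_s(X^i_s(a))\,ds+\int_0^{\tau'\wedge t}dW^i_s,\qquad a\in\mathbb{R},\ i=1,\dots,N,$$ $$A^i_t=(X^i_t)^{-1},\qquad u_t=\frac1N\sum_{i=1}^N u_0\circ A^i_t .$$ Then, almost surely, $$\tau'<\frac{N}{\|\partial_x u_0\|_{L^\infty}}.$$
   Context: Setting: $(\Omega,\Sigma,P)$ is a probability space with a filtration $\{\mathcal F_t\}_{t\ge0}$ satisfying the usual conditions, and $W^1,\dots,W^N$ are independent one-dimensional standard Wiener processes adapted to $\{\mathcal F_t\}$. The viscosity is normalized to $\nu=\frac12$, so the noise coefficient $\sqrt{2\nu}$ equals $1$. $a\wedge b=\min(a,b)$. Here the system is considered on $\mathbb{R}$ (no periodicity). $C^1(\mathbb{R})$ is the space of continuously differentiable functions on $\mathbb{R}$ with finite norm $\|f\|_{C^1}=\|f\|_{L^\infty}+\|\partial_xf\|_{L^\infty}$. For a stopping time $\tau'$, $\mathcal{C}^1([0,\tau'];\mathbb{R})$ is the set of processes $u$ on the random interval $[0,\tau']$ such that almost surely $t\mapsto u_t$ is continuous from $[0,\tau']$ into $C^1(\mathbb{R})$ and $u_{\tau'\wedge t}$ is $\mathcal F_t$-adapted. $X^i_t$ is taken in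 its modification as a stochastic flow of diffeomorphisms of $\mathbb{R}$, and $(X^i_t)^{-1}$ is its spatial inverse. Spatially independent means that the stopping time does not depend on the space variable. *)

theory Defs
  imports "HOL-Probability.Probability"
begin

section \<open>The space \<open>C\<^sup>1(\<real>)\<close>\<close>

definition Linf_norm :: "(real \<Rightarrow> real) \<Rightarrow> ennreal" where
  "Linf_norm f = esssup lborel (\<lambda>x. ennreal \<bar>f x\<bar>)"

text \<open>Since \<open>deriv\<close> is total, this is only meaningful for differentiable functions.\<close>

definition C1_norm :: "(real \<Rightarrow> real) \<Rightarrow> ennreal" where
  "C1_norm f = Linf_norm f + Linf_norm (deriv f)"

definition C1_space :: "(real \<Rightarrow> real) set" where
  "C1_space = {f. f C1_differentiable_on UNIV \<and> C1_norm f < \<infinity>}"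

definition C1_diffeomorphism :: "(real \<Rightarrow> real) \<Rightarrow> bool" where
  "C1_diffeomorphism f \<longleftrightarrow>
     bij f \<and> f C1_differentiable_on UNIV \<and> inv f C1_differentiable_on UNIV"

section \<open>Filtrations, stopping times and Wiener processes\<close>

text \<open>
  A filtration is indexed by \<^typ>\<open>ennreal\<close> and not by the nonnegative reals, so that the
  library's \<^const>\<open>filtration\<close> and \<^const>\<open>stopping_time\<close> apply to stopping
  times with values in \<open>[0, \<infinity>]\<close>. The additional member \<open>F \<infinity>\<close> is an arbitrary
  \<open>\<sigma>\<close>-algebra between all \<open>F t\<close> and \<open>M\<close>. Times of processes are real numbers \<open>t \<ge> 0\<close>.
\<close>

definition usual_conditions :: "'w measure \<Rightarrow> (ennreal \<Rightarrow> 'w measure) \<Rightarrow> bool" where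
  "usual_conditions M F \<longleftrightarrow>
     filtration (space M) F \<and> (\<forall>t. subalgebra M (F t)) \<and>
     complete_measure M \<and> null_sets M \<subseteq> sets (F 0) \<and>
     (\<forall>t<\<infinity>. sets (F t) = (\<Inter>s\<in>{t<..}. sets (F s)))"

definition adapted :: "(ennreal \<Rightarrow> 'w measure) \<Rightarrow> (real \<Rightarrow> 'w \<Rightarrow> real) \<Rightarrow> bool" where
  "adapted F Y \<longleftrightarrow> (\<forall>t\<ge>0. Y t \<in> borel_measurable (F (ennreal t)))"

definition wiener_process :: "'w measure \<Rightarrow> (real \<Rightarrow> 'w \<Rightarrow> real) \<Rightarrow> bool" where
  "wiener_process M W \<longleftrightarrow>
     (\<forall>t\<ge>0. W t \<in> borel_measurable M) \<and>
     (AE \<omega> in M. W 0 \<omega> = 0) \<and>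
     (\<forall>s t. 0 \<le> s \<longrightarrow> s < t \<longrightarrow>
        distributed M lborel (\<lambda>\<omega>. W t \<omega> - W s \<omega>) (normal_density 0 (sqrt (t - s)))) \<and>
     (\<forall>(p :: nat \<Rightarrow> real) n. 0 \<le> p 0 \<longrightarrow> mono p \<longrightarrow>
        prob_space.indep_vars M (\<lambda>_. borel) (\<lambda>k \<omega>. W (p (Suc k)) \<omega> - W (p k) \<omega>) {..<n}) \<and>
     (AE \<omega> in M. continuous_on {0..} (\<lambda>t. W t \<omega>))"

text \<open>Independence of the processes as random elements of the path space \<open>\<real>\<^bsup>[0,\<infinity>)\<^esup>\<close>.\<close>

definition indep_processes :: "'w measure \<Rightarrow> 'i set \<Rightarrow> ('i \<Rightarrow> real \<Rightarrow> 'w \<Rightarrow> real) \<Rightarrow> bool" where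
  "indep_processes M I W \<longleftrightarrow>
     prob_space.indep_vars M (\<lambda>_. Pi\<^sub>M {0..} (\<lambda>_. borel)) (\<lambda>i \<omega>. \<lambda>t\<in>{0..}. W i t \<omega>) I"

text \<open>The real number \<open>\<tau> \<and> t\<close>, where \<open>\<tau>\<close> may be infinite.\<close>

definition stopped :: "ennreal \<Rightarrow> real \<Rightarrow> real" where
  "stopped \<tau> t = enn2real (min \<tau> (ennreal t))"

text \<open>The real times in the random interval \<open>[0, \<tau>]\<close>.\<close>

definition times_upto :: "ennreal \<Rightarrow> real set" where
  "times_upto \<tau> = {t. 0 \<le> t \<and> ennreal t \<le> \<tau>}"

section \<open>Solutions of the particle system\<close>

text \<open>
  Processes \<open>u t \<omega> x\<close> on the random interval \<open>[0, \<tau>]\<close> with almost surely continuous paths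
  in \<open>C\<^sup>1(\<real>)\<close>; the values at times \<open>t > \<tau> \<omega>\<close> are irrelevant. Adaptedness of the
  function-valued process is understood pointwise in \<open>x\<close>.
\<close>

definition C1_process ::
    "'w measure \<Rightarrow> (ennreal \<Rightarrow> 'w measure) \<Rightarrow> ('w \<Rightarrow> ennreal) \<Rightarrow>
     (real \<Rightarrow> 'w \<Rightarrow> real \<Rightarrow> real) \<Rightarrow> bool" where
  "C1_process M F \<tau> u \<longleftrightarrow>
     (AE \<omega> in M. \<forall>t\<in>times_upto (\<tau> \<omega>).
        u t \<omega> \<in> C1_space \<and>
        ((\<lambda>s. C1_norm (\<lambda>x. u s \<omega> x - u t \<omega> x)) \<longlongrightarrow> 0) (at t within times_upto (\<tau> \<omega>))) \<and>
     (\<forall>x. adapted F (\<lambda>t \<omega>. u (stopped (\<tau> \<omega>) t) \<omega> x))"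

text \<open>
  The one-parameter case (initial time 0) of Kunita's notion of a stochastic flow of
  \<open>C\<^sup>1\<close> diffeomorphisms.
\<close>

definition stochastic_flow :: "'w measure \<Rightarrow> (real \<Rightarrow> 'w \<Rightarrow> real \<Rightarrow> real) \<Rightarrow> bool" where
  "stochastic_flow M X \<longleftrightarrow>
     (AE \<omega> in M.
        (\<forall>t\<ge>0. C1_diffeomorphism (X t \<omega>)) \<and>
        continuous_on ({0..} \<times> UNIV) (\<lambda>(t, a). X t \<omega> a) \<and>
        continuous_on ({0..} \<times> UNIV) (\<lambda>(t, a). deriv (X t \<omega>) a))"

text \<open>
  The integrand of the stochastic integral is 1, so the integral over \<open>[0, \<tau> \<and> t]\<close> is the
  increment of \<open>W i\<close>. For almost every \<open>\<omega>\<close> the integrand of the Lebesgue integral is a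
  continuous function of \<open>s\<close> on \<open>[0, \<tau> \<and> t]\<close>, as \<open>X i\<close> is a flow and \<open>u\<close> is a
  \<^const>\<open>C1_process\<close>. The spatial inverse of \<open>X i t\<close> is \<open>inv (X i t \<omega>)\<close>.
\<close>

definition particle_system_solution ::
    "'w measure \<Rightarrow> (ennreal \<Rightarrow> 'w measure) \<Rightarrow> nat \<Rightarrow> (nat \<Rightarrow> real \<Rightarrow> 'w \<Rightarrow> real) \<Rightarrow>
     (real \<Rightarrow> real) \<Rightarrow> ('w \<Rightarrow> ennreal) \<Rightarrow>
     (nat \<Rightarrow> real \<Rightarrow> 'w \<Rightarrow> real \<Rightarrow> real) \<Rightarrow> (real \<Rightarrow> 'w \<Rightarrow> real \<Rightarrow> real) \<Rightarrow> bool" where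
  "particle_system_solution M F N W u0 \<tau> X u \<longleftrightarrow>
     C1_process M F \<tau> u \<and>
     (\<forall>i\<in>{1..N}. stochastic_flow M (X i) \<and> (\<forall>a. adapted F (\<lambda>t \<omega>. X i t \<omega> a))) \<and>
     (AE \<omega> in M. \<forall>i\<in>{1..N}. \<forall>t\<ge>0. \<forall>a.
        X i t \<omega> a = a + (LBINT s:{0..stopped (\<tau> \<omega>) t}. u s \<omega> (X i s \<omega> a))
                      + (W i (stopped (\<tau> \<omega>) t) \<omega> - W i 0 \<omega>)) \<and>
     (AE \<omega> in M. \<forall>t\<in>times_upto (\<tau> \<omega>). \<forall>x.
        u t \<omega> x = 1 / real N * (\<Sum>i=1..N. u0 (inv (X i t \<omega>) x)))"

text \<open>
  Blow-up bounds of the form \<open>\<tau> < N / \<parallel>\<partial>\<^sub>x u0\<parallel>\<close> are stated in \<^typ>\<open>ennreal\<close>, where \<open>N / 0 = \<infinity>\<close>.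
  For constant \<open>u0\<close> such a bound only says that \<open>\<tau>\<close> is finite. Constant solutions exist for
  all times, so in this degenerate case almost sure finiteness of \<open>\<tau>\<close> has to be assumed (as part
  of the meaning of \<open>[0, \<tau>]\<close>); for all other \<open>u0\<close>, \<open>\<tau>\<close> may a priori take the value \<open>\<infinity>\<close>.
\<close>

end

theory Submission
  imports Defs
begin

text \<open>
  Each backward flow preserves the order of \<open>\<real>\<close> and \<open>u\<^sub>0\<close> is decreasing. So for \<open>a < b\<close> every one
  of the \<open>N\<close> terms of \<open>u\<^sub>s (X\<^sub>s b) - u\<^sub>s (X\<^sub>s a)\<close> is nonpositive, and one of them is
  \<open>(u\<^sub>0 b - u\<^sub>0 a) / N\<close>. The noise cancels in \<open>X\<^sub>t b - X\<^sub>t a\<close>; integrating in time gives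
  \<open>X\<^sub>t b - X\<^sub>t a \<le> b - a - (t / N) (u\<^sub>0 a - u\<^sub>0 b)\<close>. If \<open>K\<close> is a Lipschitz constant of \<open>u\<^sub>t\<close>, it
  follows that \<open>(u\<^sub>0 a - u\<^sub>0 b) / N \<le> K (b - a - (t / N) (u\<^sub>0 a - u\<^sub>0 b))\<close>. At the time \<open>t = N / L\<close> with
  \<open>L = \<parallel>\<partial>\<^sub>x u\<^sub>0\<parallel>\<close>, this bounds the Lipschitz constant of \<open>u\<^sub>0\<close> by \<open>K / (1 / N + K / L) < L\<close>, which is
  absurd. Using the Lipschitz constant of \<open>u\<^sub>t\<close> gives the strict inequality even where \<open>L\<close> is not
  attained.
\<close>

lemma C1_differentiable_on_UNIV_deriv:
  fixes f :: "real \<Rightarrow> real"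
  assumes "f C1_differentiable_on UNIV"
  shows "(f has_real_derivative deriv f x) (at x)" and "continuous_on UNIV (deriv f)"
proof -
  obtain D where D: "\<And>x. (f has_vector_derivative D x) (at x)" "continuous_on UNIV D"
    using assms by (auto simp: C1_differentiable_on_def)
  have "(f has_real_derivative D x) (at x)" for x
    using D(1) by (simp add: has_real_derivative_iff_has_vector_derivative)
  moreover from this have "deriv f = D"
    by (auto intro: DERIV_imp_deriv)
  ultimately show "(f has_real_derivative deriv f x) (at x)" "continuous_on UNIV (deriv f)"
    using D(2) by auto
qed

text \<open>The essential supremum bounds a function only almost everywhere. For continuous
  \<open>f\<close> the set of points where the bound holds is closed and of full measure, hence all
  of the line.\<close>

lemma abs_le_Linf_norm:
  assumes "continuous_on UNIV f"
  shows "ennreal \<bar>f x\<bar> \<le> Linf_norm f"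
proof -
  have f[measurable]: "f \<in> borel_measurable borel"
    using assms by (rule borel_measurable_continuous_onI)
  have "AE x in lborel. ennreal \<bar>f x\<bar> \<le> Linf_norm f"
    unfolding Linf_norm_def by (rule esssup_AE)
  then have ae: "AE x in lebesgue. x \<in> {x. ennreal \<bar>f x\<bar> \<le> Linf_norm f}"
    by (auto intro: AE_completion)
  have "closed {x. ennreal \<bar>f x\<bar> \<le> Linf_norm f}"
    using assms by (intro closed_Collect_le continuous_intros continuous_on_ennreal)
  from mem_closed_if_AE_lebesgue[OF this ae] show ?thesis
    by simp
qed

lemma Linf_norm_le:
  assumes "f \<in> borel_measurable borel" and "\<And>x. \<bar>f x\<bar> \<le> c"
  shows "Linf_norm f \<le> ennreal c"
  unfolding Linf_norm_def
  by (rule esssup_I) (use assms in \<open>auto intro!: ennreal_leI\<close>)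

lemma C1_space_lipschitz:
  assumes "f \<in> C1_space"
  obtains K where "K > 0" and "\<And>x y. \<bar>f x - f y\<bar> \<le> K * \<bar>x - y\<bar>"
proof -
  have C1: "f C1_differentiable_on UNIV" and "C1_norm f < \<infinity>"
    using assms by (auto simp: C1_space_def)
  then have fin: "Linf_norm (deriv f) < \<infinity>"
    by (auto simp: C1_norm_def)
  \<comment> \<open>The summand 1 keeps \<open>K\<close> positive when the derivative vanishes
    identically.\<close>
  define K where "K = enn2real (Linf_norm (deriv f)) + 1"
  have "\<bar>deriv f x\<bar> \<le> K" for x
    using enn2real_mono[OF abs_le_Linf_norm[OF C1_differentiable_on_UNIV_deriv(2)[OF C1], of x]] fin
    by (auto simp: K_def)
  then have "norm (f x - f y) \<le> K * norm (x - y)" for x y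
    using C1_differentiable_on_UNIV_deriv(1)[OF C1]
    by (intro field_differentiable_bound[of UNIV f "deriv f"]) auto
  moreover have "K > 0"
    by (simp add: K_def add_nonneg_pos)
  ultimately show ?thesis
    using that by auto
qed

text \<open>Since the derivative exists, it is the limit of right difference quotients alone, and
  these are bounded by \<open>c\<close>.\<close>

lemma Linf_norm_deriv_le_lipschitz:
  assumes C1: "f C1_differentiable_on UNIV"
    and lip: "\<And>a b. a < b \<Longrightarrow> \<bar>f b - f a\<bar> \<le> c * (b - a)"
  shows "Linf_norm (deriv f) \<le> ennreal c"
proof (rule Linf_norm_le)
  show "deriv f \<in> borel_measurable borel"
    using C1_differentiable_on_UNIV_deriv(2)[OF C1] by (rule borel_measurable_continuous_onI)
  fix x
  have "((\<lambda>y. (f y - f x) / (y - x)) \<longlongrightarrow> deriv f x) (at_right x)"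
    using C1_differentiable_on_UNIV_deriv(1)[OF C1, of x]
    by (auto simp: has_field_derivative_iff intro: tendsto_within_subset)
  then have lim: "((\<lambda>y. \<bar>(f y - f x) / (y - x)\<bar>) \<longlongrightarrow> \<bar>deriv f x\<bar>) (at_right x)"
    by (rule tendsto_rabs)
  have "\<forall>\<^sub>F y in at_right x. \<bar>(f y - f x) / (y - x)\<bar> \<le> c"
    using eventually_at_right_less[of x]
    by eventually_elim (use lip in \<open>auto simp: divide_le_eq\<close>)
  then show "\<bar>deriv f x\<bar> \<le> c"
    using tendsto_upperbound[OF lim] by simp
qed

text \<open>Split the increment into \<open>v s (z s) - v t (z s)\<close>, which the C1 norm
  controls uniformly in space, and \<open>v t (z s) - v t (z t)\<close>, which is small by
  continuity of \<open>v t\<close>. This makes the drift along a trajectory integrable in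
  time.\<close>

lemma continuous_on_comp_C1_path:
  fixes v :: "real \<Rightarrow> real \<Rightarrow> real"
  assumes C1: "\<And>t. t \<in> S \<Longrightarrow> v t \<in> C1_space"
    and lim: "\<And>t. t \<in> S \<Longrightarrow> ((\<lambda>s. C1_norm (\<lambda>x. v s x - v t x)) \<longlongrightarrow> 0) (at t within S)"
    and z: "continuous_on S z"
  shows "continuous_on S (\<lambda>s. v s (z s))"
  unfolding continuous_on_def
proof
  fix t assume t: "t \<in> S"
  have cont: "continuous_on UNIV (v s)" if "s \<in> S" for s
    using C1[OF that] by (auto simp: C1_space_def intro: C1_differentiable_imp_continuous_on)
  have le: "ennreal \<bar>v s (z s) - v t (z s)\<bar> \<le> C1_norm (\<lambda>x. v s x - v t x)" if "s \<in> S" for s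
    using abs_le_Linf_norm[of "\<lambda>x. v s x - v t x" "z s"] cont[OF that] cont[OF t]
    by (auto simp: C1_norm_def intro!: continuous_intros add_increasing2)
  have "((\<lambda>s. ennreal \<bar>v s (z s) - v t (z s)\<bar>) \<longlongrightarrow> ennreal 0) (at t within S)"
    unfolding ennreal_0
    by (rule tendsto_sandwich[OF _ _ tendsto_const lim[OF t]])
       (use le in \<open>auto simp: eventually_at_filter\<close>)
  then have "((\<lambda>s. \<bar>v s (z s) - v t (z s)\<bar>) \<longlongrightarrow> 0) (at t within S)"
    by (subst (asm) tendsto_ennreal_iff) auto
  then have "((\<lambda>s. v s (z s) - v t (z s)) \<longlongrightarrow> 0) (at t within S)"
    by (simp add: tendsto_rabs_zero_iff)
  moreover have "((\<lambda>s. v t (z s)) \<longlongrightarrow> v t (z t)) (at t within S)"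
    using continuous_on_compose2[OF cont[OF t] z] t by (auto simp: continuous_on_def)
  ultimately show "((\<lambda>s. v s (z s)) \<longlongrightarrow> v t (z t)) (at t within S)"
    using tendsto_add by fastforce
qed

text \<open>Two trajectories that start in order can only lose their order by meeting at some
  earlier time (intermediate value theorem), which injectivity forbids.\<close>

lemma injective_isotopy_strict_mono:
  fixes Y :: "real \<Rightarrow> real \<Rightarrow> real"
  assumes inj: "\<And>t. t \<ge> 0 \<Longrightarrow> inj (Y t)"
    and cont: "\<And>a. continuous_on {0..} (\<lambda>t. Y t a)"
    and init: "\<And>a. Y 0 a = a"
    and t: "t \<ge> 0"
  shows "strict_mono (Y t)"
proof (rule strict_monoI, rule ccontr)
  fix a b :: real assume ab: "a < b" and "\<not> Y t a < Y t b"
  moreover have "continuous_on {0..t} (\<lambda>s. Y s b - Y s a)"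
    using cont[of a] cont[of b] by (auto intro!: continuous_intros intro: continuous_on_subset)
  ultimately obtain s where "0 \<le> s" "Y s b - Y s a = 0"
    using IVT2'[of "\<lambda>s. Y s b - Y s a" t 0 0] t init by auto
  then show False
    using inj[of s] ab by (auto dest: injD)
qed

lemma mono_inv_strict_mono:
  fixes f :: "real \<Rightarrow> real"
  assumes "bij f" and "strict_mono f"
  shows "mono (inv f)"
  using assms
  by (intro monoI) (metis bij_inv_eq_iff strict_mono_less_eq)

text \<open>The deterministic core, for one fixed path. The noise enters only as the number
  \<open>w\<close>; it does not depend on the starting point, so it drops out of differences of
  trajectories.\<close>

lemma particle_path_contradiction:
  fixes v :: "real \<Rightarrow> real \<Rightarrow> real" and Y :: "'i \<Rightarrow> real \<Rightarrow> real \<Rightarrow> real" and w :: real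
  assumes I: "finite I" "i \<in> I"
    and T: "T \<ge> 0"
    and f: "f C1_differentiable_on UNIV" "antimono f"
    and L: "L > 0" "Linf_norm (deriv f) = ennreal L" "T = real (card I) / L"
    and C1: "\<And>t. t \<in> {0..T} \<Longrightarrow> v t \<in> C1_space"
    and lim: "\<And>t. t \<in> {0..T} \<Longrightarrow>
      ((\<lambda>s. C1_norm (\<lambda>x. v s x - v t x)) \<longlongrightarrow> 0) (at t within {0..T})"
    and bij: "\<And>j t. j \<in> I \<Longrightarrow> t \<ge> 0 \<Longrightarrow> bij (Y j t)"
    and cont: "\<And>j a. j \<in> I \<Longrightarrow> continuous_on {0..} (\<lambda>t. Y j t a)"
    and init: "\<And>j a. j \<in> I \<Longrightarrow> Y j 0 a = a"
    and eq: "\<And>a. Y i T a = a + (LBINT s:{0..T}. v s (Y i s a)) + w"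
    and v: "\<And>t x. t \<in> {0..T} \<Longrightarrow> v t x = 1 / real (card I) * (\<Sum>j\<in>I. f (inv (Y j t) x))"
  shows False
proof -
  define n where "n = real (card I)"
  have n: "n > 0"
    using I by (auto simp: n_def card_gt_0_iff)
  have sm: "strict_mono (Y j t)" if "j \<in> I" "t \<ge> 0" for j t
    by (rule injective_isotopy_strict_mono[OF bij_is_inj[OF bij[OF that(1)]] cont[OF that(1)]
          init[OF that(1)] that(2)])
  have decr: "v t (Y i t b) - v t (Y i t a) \<le> (f b - f a) / n"
    if t: "t \<in> {0..T}" and ab: "a < b" for a b t
  proof -
    have mon: "f (inv (Y j t) (Y i t b)) \<le> f (inv (Y j t) (Y i t a))" if "j \<in> I" for j
    proof -
      have "mono (inv (Y j t))"
        using that t by (intro mono_inv_strict_mono bij sm) auto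
      moreover have "Y i t a \<le> Y i t b"
        using sm[OF I(2), of t] t ab by (simp add: strict_mono_less_eq)
      ultimately show ?thesis
        by (intro antimonoD[OF f(2)] monoD[of "inv (Y j t)"])
    qed
    have "v t (Y i t b) - v t (Y i t a)
        = (\<Sum>j\<in>I. f (inv (Y j t) (Y i t b)) - f (inv (Y j t) (Y i t a))) / n"
      using t by (simp add: v n_def sum_subtractf diff_divide_distrib)
    \<comment> \<open>The terms with \<open>j\<close> other than \<open>i\<close> are nonpositive
      and are dropped; in the remaining one the flow cancels its own inverse.\<close>
    also have "(\<Sum>j\<in>I. f (inv (Y j t) (Y i t b)) - f (inv (Y j t) (Y i t a)))
        \<le> f (inv (Y i t) (Y i t b)) - f (inv (Y i t) (Y i t a))"
      unfolding sum.remove[OF I] using mon by (intro add_decreasing2 sum_nonpos) auto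
    also have "\<dots> = f b - f a"
      using bij[of i t] I t by (simp add: bij_is_inj inv_f_f)
    finally show ?thesis
      using n by (simp add: divide_right_mono)
  qed
  have intg: "set_integrable lborel {0..T} (\<lambda>s. v s (Y i s a))" for a
  proof (rule borel_integrable_atLeastAtMost'[OF continuous_on_comp_C1_path[OF C1 lim]])
    show "continuous_on {0..T} (\<lambda>s. Y i s a)"
      by (rule continuous_on_subset[OF cont[OF I(2)]]) auto
  qed
  have gap: "Y i T b - Y i T a \<le> (b - a) + T * ((f b - f a) / n)" if ab: "a < b" for a b
  proof -
    have "Y i T b - Y i T a = (b - a) + (LBINT s:{0..T}. v s (Y i s b) - v s (Y i s a))"
      by (simp add: eq set_integral_diff(2)[OF intg intg])
    also have "(LBINT s:{0..T}. v s (Y i s b) - v s (Y i s a)) \<le> (LBINT s:{0..T}. (f b - f a) / n)"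
      by (intro set_integral_mono set_integral_diff(1) intg decr[OF _ ab]
          borel_integrable_atLeastAtMost' continuous_on_const)
    also have "\<dots> = T * ((f b - f a) / n)"
      using T by (simp add: set_lebesgue_integral_def)
    finally show ?thesis
      by simp
  qed
  obtain K where K: "K > 0" "\<And>x y. \<bar>v T x - v T y\<bar> \<le> K * \<bar>x - y\<bar>"
    using C1_space_lipschitz[OF C1[of T]] T by auto
  \<comment> \<open>The value that results from solving
    \<open>d / n \<le> K * ((b - a) - d / L)\<close> for \<open>d\<close>, the decrease of
    \<open>f\<close> from \<open>a\<close> to \<open>b\<close>.\<close>
  define c where "c = K / (1 / n + K / L)"
  have "\<bar>f b - f a\<bar> \<le> c * (b - a)" if ab: "a < b" for a b
  proof -
    define d where "d = f a - f b"
    have d: "d \<ge> 0"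
      using antimonoD[OF f(2), of a b] ab by (simp add: d_def)
    have "Y i T a < Y i T b"
      using sm[of i T] I T ab by (auto dest: strict_monoD)
    then have "d / n \<le> K * (Y i T b - Y i T a)"
      using K(2)[of "Y i T b" "Y i T a"] decr[OF _ ab, of T] T
      by (simp add: d_def diff_divide_distrib)
    also have "\<dots> \<le> K * ((b - a) - d / L)"
    proof (intro mult_left_mono)
      \<comment> \<open>Here the choice of the time enters: \<open>T = n / L\<close>, so
        \<open>T / n = 1 / L\<close>.\<close>
      have "T * ((f b - f a) / n) = - (d / L)"
        using n L(1,3) by (simp add: d_def n_def[symmetric] minus_divide_left)
      then show "Y i T b - Y i T a \<le> (b - a) - d / L"
        using gap[OF ab] by simp
    qed (use K(1) in simp)
    finally have "d * (1 / n + K / L) \<le> K * (b - a)"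
      by (simp add: algebra_simps)
    moreover have "1 / n + K / L > 0"
      using n K(1) L(1) by (simp add: add_pos_pos)
    ultimately have "d \<le> c * (b - a)"
      unfolding c_def times_divide_eq_left by (simp add: pos_le_divide_eq)
    then show ?thesis
      using d by (simp add: d_def)
  qed
  then have "ennreal L \<le> ennreal c"
    using Linf_norm_deriv_le_lipschitz[OF f(1)] L(2) by simp
  \<comment> \<open>Clearing the denominator turns this into \<open>K < L / n + K\<close>. As
    \<open>ennreal\<close> truncates negative numbers to 0, positivity of \<open>L\<close> is what
    carries the opposite inequality back to the reals.\<close>
  moreover have "c < L"
    using n K(1) L(1) unfolding c_def by (simp add: pos_divide_less_eq add_pos_pos distrib_left)
  ultimately show False
    using L(1) by (auto simp: ennreal_le_iff2)
qed

theorem proposition3p1: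
  fixes M :: "'w measure" and F :: "ennreal \<Rightarrow> 'w measure"
    and N :: nat and W :: "nat \<Rightarrow> real \<Rightarrow> 'w \<Rightarrow> real"
    and u0 :: "real \<Rightarrow> real" and \<tau> :: "'w \<Rightarrow> ennreal"
    and X :: "nat \<Rightarrow> real \<Rightarrow> 'w \<Rightarrow> real \<Rightarrow> real" and u :: "real \<Rightarrow> 'w \<Rightarrow> real \<Rightarrow> real"
  assumes "prob_space M" and "usual_conditions M F"
    and "N \<ge> 2"
    and "\<And>i. i \<in> {1..N} \<Longrightarrow> wiener_process M (W i)"
    and "\<And>i. i \<in> {1..N} \<Longrightarrow> adapted F (W i)"
    and "indep_processes M {1..N} W"
    and "u0 \<in> C1_space" and "antimono u0"
    and "stopping_time F \<tau>"
    and "Linf_norm (deriv u0) = 0 \<Longrightarrow> AE \<omega> in M. \<tau> \<omega> < \<infinity>"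
    and "particle_system_solution M F N W u0 \<tau> X u"
  shows "AE \<omega> in M. \<tau> \<omega> < ennreal (real N) / Linf_norm (deriv u0)"
proof (cases "Linf_norm (deriv u0) = 0")
  case True
  then show ?thesis
    \<comment> \<open>Division of a positive number by 0 gives \<infinity>, so only finiteness of
      \<open>\<tau>\<close> is claimed.\<close>
    using assms(3,10) by (simp add: ennreal_divide_zero)
next
  case False
  have C1: "u0 C1_differentiable_on UNIV" and "Linf_norm (deriv u0) < \<infinity>"
    using assms(7) by (auto simp: C1_space_def C1_norm_def)
  then obtain L where L: "Linf_norm (deriv u0) = ennreal L" "L > 0"
    using False by (cases "Linf_norm (deriv u0)") (auto simp: less_le)
  define T where "T = real N / L"
  have T: "T \<ge> 0" and NT: "ennreal (real N) / Linf_norm (deriv u0) = ennreal T"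
    using L by (auto simp: T_def divide_ennreal)
  have sol:
    "AE \<omega> in M. \<forall>t\<in>times_upto (\<tau> \<omega>). u t \<omega> \<in> C1_space \<and>
       ((\<lambda>s. C1_norm (\<lambda>x. u s \<omega> x - u t \<omega> x)) \<longlongrightarrow> 0) (at t within times_upto (\<tau> \<omega>))"
    "AE \<omega> in M. \<forall>i\<in>{1..N}. \<forall>t\<ge>0. \<forall>a.
       X i t \<omega> a = a + (LBINT s:{0..stopped (\<tau> \<omega>) t}. u s \<omega> (X i s \<omega> a))
         + (W i (stopped (\<tau> \<omega>) t) \<omega> - W i 0 \<omega>)"
    "AE \<omega> in M. \<forall>t\<in>times_upto (\<tau> \<omega>). \<forall>x.
       u t \<omega> x = 1 / real N * (\<Sum>i=1..N. u0 (inv (X i t \<omega>) x))"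
    using assms(11) by (auto simp: particle_system_solution_def C1_process_def)
  \<comment> \<open>There are finitely many particles, so one null set serves for all of
    them.\<close>
  have flow: "AE \<omega> in M. \<forall>i\<in>{1..N}. (\<forall>t\<ge>0. C1_diffeomorphism (X i t \<omega>)) \<and>
      continuous_on ({0..} \<times> UNIV) (\<lambda>(t, a). X i t \<omega> a)"
    using assms(11)
    by (intro AE_finite_allI) (auto simp: particle_system_solution_def stochastic_flow_def)
  from sol flow show ?thesis
  proof eventually_elim
    case (elim \<omega>)
    note C1_path = elim(1) and X_eq = elim(2) and u_eq = elim(3) and X_flow = elim(4)
    show ?case
      unfolding NT
    proof (rule ccontr)
      assume "\<not> \<tau> \<omega> < ennreal T"
      then have le: "ennreal T \<le> \<tau> \<omega>"
        by simp
      \<comment> \<open>The random interval contains its right end when that is finite, so \<tau> =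
        T is refuted as well and the bound is strict.\<close>
      then have sub: "{0..T} \<subseteq> times_upto (\<tau> \<omega>)"
        by (auto simp: times_upto_def intro: order_trans[OF ennreal_leI])
      have "stopped (\<tau> \<omega>) T = T" and stopped0: "stopped (\<tau> \<omega>) 0 = 0"
        using le T by (simp_all add: stopped_def min_def)
      then have at_T: "X 1 T \<omega> a = a + (LBINT s:{0..T}. u s \<omega> (X 1 s \<omega> a)) + (W 1 T \<omega> - W 1 0 \<omega>)"
        for a
        using X_eq[rule_format, of 1 T a] T assms(3) by simp
      \<comment> \<open>At time 0 the drift integral runs over a single point and the noise
        increment is \<open>W i 0 \<omega> - W i 0 \<omega>\<close>, so both vanish.\<close>
      have init: "X i 0 \<omega> a = a" if "i \<in> {1..N}" for i a
      proof -
        have "(LBINT s:{0..0}. u s \<omega> (X i s \<omega> a)) = 0"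
          unfolding set_lebesgue_integral_def
          using AE_lborel_singleton[of "0::real"]
          by (intro integral_eq_zero_AE) (auto elim!: eventually_mono)
        then show ?thesis
          using X_eq[rule_format, OF that, of 0 a] stopped0 by simp
      qed
      have cont: "continuous_on {0..} (\<lambda>t. X i t \<omega> a)" if "i \<in> {1..N}" for i a
        using continuous_on_compose2[OF conjunct2[OF X_flow[rule_format, OF that]],
            of "{0..}" "\<lambda>t. (t, a)"]
        by (force intro!: continuous_intros)
      show False
      \<comment> \<open>Any particle would serve as the distinguished one; its noise increment up to
        \<open>T\<close> becomes \<open>w\<close>.\<close>
      proof (rule particle_path_contradiction[where I = "{1..N}" and i = 1 and f = u0
            and v = "\<lambda>t. u t \<omega>" and Y = "\<lambda>i t. X i t \<omega>" and T = T
            and w = "W 1 T \<omega> - W 1 0 \<omega>"])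
        show "((\<lambda>s. C1_norm (\<lambda>x. u s \<omega> x - u t \<omega> x)) \<longlongrightarrow> 0) (at t within {0..T})"
          if "t \<in> {0..T}" for t
          using C1_path sub that by (blast intro: tendsto_within_subset)
        show "u t \<omega> x = 1 / real (card {1..N}) * (\<Sum>j\<in>{1..N}. u0 (inv (X j t \<omega>) x))"
          if "t \<in> {0..T}" for t x
          using u_eq sub that by auto
        show "T = real (card {1..N}) / L"
          by (simp add: T_def)
        show "u t \<omega> \<in> C1_space" if "t \<in> {0..T}" for t
          using C1_path sub that by blast
        show "bij (X j t \<omega>)" if "j \<in> {1..N}" "t \<ge> 0" for j t
          using X_flow that by (auto simp: C1_diffeomorphism_def)
        show "(1::nat) \<in> {1..N}"
          using assms(3) by simp
      qed (fact finite_atLeastAtMost T C1 assms(8) L init cont at_T)+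
    qed
  qed
qed

end
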